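(* Let $X$ be a non-amenable UDBG space and let $k\in\mathbb{N}$. Then the $\ell^\infty$-semi-norm on $H^{\mathrm{uf}}_k(X;\mathbb{R})$ is trivial, i.e., $\|\alpha\|_\infty=0$ for all $\alpha\in H^{\mathrm{uf}}_k(X;\mathbb{R})$.
   Context: $\mathbb{N}=\{0,1,2,\dots\}$. A metric space $X$ is a UDBG space if (i) there is $\varepsilon>0$ such that for all $x,y\in X$: $d(x,y)<\varepsilon$ if and only if $x=y$; and (ii) for every $r>0$ there is $K>0$ with $|B_r(x)|<K$ for all $x\in X$. A UDBG space $X$ is amenable if there is a sequence $(S_n)_{n\in\mathbb{N}}$ of non-empty finite subsets of $X$ (a Følner sequence) such that $\lim_{n\to\infty}|\partial_r(S_n)|/|S_n|=0$ for every $r>0$, where $\partial_r(S)=\{x\in X\setminus S : d(x,S)\le r\}$ is the $r$-boundary of $S$. It is non-amenable otherwise. Uniformly finite homology: let $R=\mathbb{R}$ with the standard absolute value $|\cdot|$. For a UDBG space $X$ and $n\in\mathbb{N}$, $C^{\mathrm{uf}}_n(X;R)$ is the $R$-module of functions $X^{n+1}\to R$, written as formal sums $c=\sum_{x\in X^{n+1}}c_x\cdot x$, such that $\sup_x|c_x|<\infty$ and there is a constant $\rho>0$ (depending on $c$) with $c_x=0$ whenever $x=(x_0,\dots,x_n)$ satisfies $\sup_{i,j}d(x_i,x_j)>\rho$. The boundary operator $\partial_n\colon C^{\mathrm{uf}}_n(X;R)\to C^{\mathrm{uf}}_{n-1}(X;R)$ is the extension to such (possibly infinite) sums of $(x_0,\dots,x_n)\mapsto\sum_{j=0}^n(-1)^j(x_0,\dots,\widehat{x_j},\dots,x_n)$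 (and every $0$-chain is a cycle). $H^{\mathrm{uf}}_*(X;R)$ is the homology of this chain complex. The $\ell^\infty$-norm on chains is $\|\sum_x c_x\cdot x\|_\infty=\sup_x|c_x|$, and the $\ell^\infty$-semi-norm of $\alpha\in H^{\mathrm{uf}}_n(X;R)$ is $\|\alpha\|_\infty=\inf\{\|c\|_\infty : c\in C^{\mathrm{uf}}_n(X;R),\ \partial c=0,\ [c]=\alpha\}$. *)

theory Defs
  imports "HOL-Analysis.Analysis"
begin

section \<open>UDBG spaces and amenability\<close>

text \<open>Uniformly discrete metric spaces of bounded geometry. Finiteness of balls is stated
  separately because \<^const>\<open>card\<close> is \<open>0\<close> on infinite sets.\<close>

locale UDBG_space = Metric_space +
  assumes uniformly_discrete:
    "\<exists>\<epsilon>>0. \<forall>x\<in>M. \<forall>y\<in>M. d x y < \<epsilon> \<longleftrightarrow> x = y"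
  and bounded_geometry:
    "\<And>r::real. r > 0 \<Longrightarrow>
       \<exists>K::real. K > 0 \<and> (\<forall>x\<in>M. finite (mball x r) \<and> real (card (mball x r)) < K)"

definition r_boundary :: "'a set \<Rightarrow> ('a \<Rightarrow> 'a \<Rightarrow> real) \<Rightarrow> real \<Rightarrow> 'a set \<Rightarrow> 'a set" where
  "r_boundary X d r S = {x \<in> X - S. (INF s\<in>S. d x s) \<le> r}"

definition Folner_sequence ::
    "'a set \<Rightarrow> ('a \<Rightarrow> 'a \<Rightarrow> real) \<Rightarrow> (nat \<Rightarrow> 'a set) \<Rightarrow> bool" where
  "Folner_sequence X d S \<longleftrightarrow>
     (\<forall>n. S n \<subseteq> X \<and> finite (S n) \<and> S n \<noteq> {}) \<and>
     (\<forall>r>0. (\<lambda>n. real (card (r_boundary X d r (S n))) / real (card (S n))) \<longlonglongrightarrow> 0)"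

definition amenable :: "'a set \<Rightarrow> ('a \<Rightarrow> 'a \<Rightarrow> real) \<Rightarrow> bool" where
  "amenable X d \<longleftrightarrow> (\<exists>S. Folner_sequence X d S)"


section \<open>Uniformly finite homology with real coefficients\<close>

text \<open>A tuple in \<open>X\<^sup>n\<^sup>+\<^sup>1\<close> is a list of length \<open>n + 1\<close>, and a chain is a function on all lists
  that vanishes outside \<open>X\<^sup>n\<^sup>+\<^sup>1\<close>.\<close>

definition tuples :: "'a set \<Rightarrow> nat \<Rightarrow> 'a list set" where
  "tuples X n = {x. length x = n + 1 \<and> set x \<subseteq> X}"

definition uf_chains :: "'a set \<Rightarrow> ('a \<Rightarrow> 'a \<Rightarrow> real) \<Rightarrow> nat \<Rightarrow> ('a list \<Rightarrow> real) set" where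
  "uf_chains X d n = {c.
     (\<forall>x. x \<notin> tuples X n \<longrightarrow> c x = 0) \<and>
     bdd_above (range (\<lambda>x. \<bar>c x\<bar>)) \<and>
     (\<exists>\<rho>>0. \<forall>x\<in>tuples X n.
        (SUP (i, j)\<in>{..n} \<times> {..n}. d (x ! i) (x ! j)) > \<rho> \<longrightarrow> c x = 0)}"

definition face :: "nat \<Rightarrow> 'a list \<Rightarrow> 'a list" where
  "face j x = take j x @ drop (Suc j) x"

text \<open>The coefficient of \<open>\<partial>c\<close> at \<open>y\<close> collects the contributions of all simplices of \<open>c\<close> having
  \<open>y\<close> as a face (possibly several times). For uniformly finite chains on a UDBG space and
  \<open>n > 0\<close> the outer index set is finite, see \<open>finite_cofaces\<close> below. The case \<open>n = 0\<close> is
  separate, as otherwise the empty list would give an augmentation.\<close>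

definition uf_boundary :: "nat \<Rightarrow> ('a list \<Rightarrow> real) \<Rightarrow> 'a list \<Rightarrow> real" where
  "uf_boundary n c = (if n = 0 then (\<lambda>y. 0) else
     (\<lambda>y. \<Sum>x | c x \<noteq> 0 \<and> (\<exists>j\<le>n. face j x = y).
        c x * (\<Sum>j | j \<le> n \<and> face j x = y. (-1) ^ j)))"

definition uf_cycles :: "'a set \<Rightarrow> ('a \<Rightarrow> 'a \<Rightarrow> real) \<Rightarrow> nat \<Rightarrow> ('a list \<Rightarrow> real) set" where
  "uf_cycles X d n = {c \<in> uf_chains X d n. uf_boundary n c = (\<lambda>y. 0)}"

definition uf_boundaries :: "'a set \<Rightarrow> ('a \<Rightarrow> 'a \<Rightarrow> real) \<Rightarrow> nat \<Rightarrow> ('a list \<Rightarrow> real) set" where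
  "uf_boundaries X d n = uf_boundary (n + 1) ` uf_chains X d (n + 1)"

definition uf_homologous ::
    "'a set \<Rightarrow> ('a \<Rightarrow> 'a \<Rightarrow> real) \<Rightarrow> nat \<Rightarrow> (('a list \<Rightarrow> real) \<times> ('a list \<Rightarrow> real)) set" where
  "uf_homologous X d n = {(c, c').
     c \<in> uf_cycles X d n \<and> c' \<in> uf_cycles X d n \<and> (\<lambda>x. c x - c' x) \<in> uf_boundaries X d n}"

text \<open>Homology classes are the cosets of the boundaries in the cycles.\<close>

definition uf_homology ::
    "'a set \<Rightarrow> ('a \<Rightarrow> 'a \<Rightarrow> real) \<Rightarrow> nat \<Rightarrow> ('a list \<Rightarrow> real) set set" where
  "uf_homology X d n = uf_cycles X d n // uf_homologous X d n"

text \<open>Taking the supremum over all lists is harmless since chains vanish outside \<open>X\<^sup>n\<^sup>+\<^sup>1\<close>, and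
  avoids a supremum over the empty set if \<open>X\<close> is empty.\<close>

definition linf_norm :: "('a list \<Rightarrow> real) \<Rightarrow> real" where
  "linf_norm c = (SUP x. \<bar>c x\<bar>)"

definition linf_seminorm ::
    "'a set \<Rightarrow> ('a \<Rightarrow> 'a \<Rightarrow> real) \<Rightarrow> nat \<Rightarrow> ('a list \<Rightarrow> real) set \<Rightarrow> real" where
  "linf_seminorm X d n \<alpha> =
     Inf {linf_norm c | c. c \<in> uf_cycles X d n \<and> uf_homologous X d n `` {c} = \<alpha>}"


section \<open>Well-definedness of the boundary operator and of homology classes\<close>

lemma (in UDBG_space) finite_cofaces:
  assumes c: "c \<in> uf_chains M d n" and n: "n > 0"
  shows "finite {x. c x \<noteq> 0 \<and> (\<exists>j\<le>n. face j x = y)}"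
proof -
  from c obtain \<rho> where \<rho>: "\<rho> > 0" and supp: "\<And>x. c x \<noteq> 0 \<Longrightarrow> x \<in> tuples M n"
    and ctrl: "\<And>x. c x \<noteq> 0 \<Longrightarrow> (SUP (i, j)\<in>{..n} \<times> {..n}. d (x ! i) (x ! j)) \<le> \<rho>"
    unfolding uf_chains_def by (auto simp: not_less[symmetric])
  have dist: "d u v \<le> \<rho>" if uv: "c x \<noteq> 0" "u \<in> set x" "v \<in> set x" for x u v
  proof -
    have len: "length x = n + 1" using supp[OF that(1)] by (simp add: tuples_def)
    obtain i j where ij: "i \<le> n" "j \<le> n" "u = x ! i" "v = x ! j"
      using uv(2,3) len by (auto simp: in_set_conv_nth less_Suc_eq_le)
    have "d u v \<le> (SUP (i, j)\<in>{..n} \<times> {..n}. d (x ! i) (x ! j))"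
      using ij by (intro cSUP_upper2[where x = "(i, j)"] bdd_above_finite finite_imageI) auto
    with ctrl[OF that(1)] show ?thesis by linarith
  qed
  show ?thesis
  proof (cases "y \<noteq> [] \<and> hd y \<in> M")
    case True
    have fin: "finite (mball (hd y) (\<rho> + 1))"
      using bounded_geometry[of "\<rho> + 1"] \<rho> True by auto
    have "{x. c x \<noteq> 0 \<and> (\<exists>j\<le>n. face j x = y)}
        \<subseteq> {x. set x \<subseteq> mball (hd y) (\<rho> + 1) \<and> length x = n + 1}"
    proof safe
      fix x j v assume x: "c x \<noteq> 0" "y = face j x" and v: "v \<in> set x"
      have "hd y \<in> set y" using True by auto
      also have "set y \<subseteq> set x"
        using x(2) by (auto simp: face_def dest: in_set_takeD in_set_dropD)
      finally have "d (hd y) v \<le> \<rho>" using dist x(1) v by blast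
      moreover have "v \<in> M" using supp[OF x(1)] v by (auto simp: tuples_def)
      ultimately show "v \<in> mball (hd (face j x)) (\<rho> + 1)" using True x(2) by auto
    next
      fix x assume "c x \<noteq> 0"
      from supp[OF this] show "length x = n + 1" by (simp add: tuples_def)
    qed
    thus ?thesis using finite_lists_length_eq[OF fin] finite_subset by blast
  next
    case False
    have "y \<noteq> [] \<and> hd y \<in> M" if "c x \<noteq> 0" "j \<le> n" "face j x = y" for x j
    proof -
      have x: "length x = n + 1" "set x \<subseteq> M" using supp[OF that(1)] by (auto simp: tuples_def)
      have "length y = n" using x(1) that(2,3) by (auto simp: face_def)
      moreover have "set y \<subseteq> M"
        unfolding that(3)[symmetric] face_def set_append
        using x(2) set_take_subset[of j x] set_drop_subset[of "Suc j" x] by blast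
      ultimately have "length y = n" "set y \<subseteq> M" .
      thus ?thesis using n by (cases y) auto
    qed
    hence "{x. c x \<noteq> 0 \<and> (\<exists>j\<le>n. face j x = y)} = {}" using False by blast
    thus ?thesis by (simp only: finite.emptyI)
  qed
qed

lemma uf_chains_diff:
  assumes "c \<in> uf_chains X d n" "c' \<in> uf_chains X d n"
  shows "(\<lambda>x. c x - c' x) \<in> uf_chains X d n"
proof -
  let ?D = "\<lambda>x. SUP (i, j)\<in>{..n} \<times> {..n}. d (x ! i) (x ! j)"
  from assms(1) obtain \<rho> K where *: "\<rho> > 0"
    and s: "\<And>x. x \<in> tuples X n \<Longrightarrow> ?D x > \<rho> \<Longrightarrow> c x = 0" and K: "\<And>x. \<bar>c x\<bar> \<le> K"
    unfolding uf_chains_def bdd_above_def by blast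
  from assms(2) obtain \<rho>' K' where *: "\<rho> > 0" "\<rho>' > 0"
    and s': "\<And>x. x \<in> tuples X n \<Longrightarrow> ?D x > \<rho>' \<Longrightarrow> c' x = 0" and K': "\<And>x. \<bar>c' x\<bar> \<le> K'"
    using * unfolding uf_chains_def bdd_above_def by blast
  have "\<bar>c x - c' x\<bar> \<le> K + K'" for x using K[of x] K'[of x] by linarith
  hence "bdd_above (range (\<lambda>x. \<bar>c x - c' x\<bar>))" by (intro bdd_aboveI[of _ "K + K'"]) auto
  moreover have "\<exists>r>0. \<forall>x\<in>tuples X n.
      ?D x > r \<longrightarrow> c x - c' x = 0"
    using * s s' by (intro exI[of _ "max \<rho> \<rho>'"]) auto
  ultimately show ?thesis using assms unfolding uf_chains_def by auto
qed

lemma uf_boundary_superset: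
  assumes "n > 0" "finite A" "{x. c x \<noteq> 0 \<and> (\<exists>j\<le>n. face j x = y)} \<subseteq> A"
  shows "uf_boundary n c y = (\<Sum>x\<in>A. c x * (\<Sum>j | j \<le> n \<and> face j x = y. (-1) ^ j))"
proof -
  have "(\<Sum>j | j \<le> n \<and> face j x = y. (-1) ^ j) = (0::real)" if "\<not> (\<exists>j\<le>n. face j x = y)" for x
    using that by (intro sum.neutral) auto
  hence "(\<Sum>x | c x \<noteq> 0 \<and> (\<exists>j\<le>n. face j x = y).
           c x * (\<Sum>j | j \<le> n \<and> face j x = y. (-1) ^ j)) =
         (\<Sum>x\<in>A. c x * (\<Sum>j | j \<le> n \<and> face j x = y. (-1) ^ j))"
    by (intro sum.mono_neutral_left assms) force
  thus ?thesis using assms(1) by (simp add: uf_boundary_def)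
qed

lemma (in UDBG_space) uf_boundary_diff:
  assumes "c \<in> uf_chains M d n" "c' \<in> uf_chains M d n"
  shows "uf_boundary n (\<lambda>x. c x - c' x) = (\<lambda>y. uf_boundary n c y - uf_boundary n c' y)"
proof (cases "n = 0")
  case False
  show ?thesis
  proof
    fix y :: "'a list"
    let ?S = "\<lambda>c. {x. c x \<noteq> (0::real) \<and> (\<exists>j\<le>n. face j x = y)}"
    have fin: "finite (?S c \<union> ?S c')" using finite_cofaces assms False by blast
    have n: "n > 0" using False by simp
    let ?e = "\<lambda>x. \<Sum>j | j \<le> n \<and> face j x = y. (-1) ^ j :: real"
    let ?A = "?S c \<union> ?S c'"
    have "uf_boundary n (\<lambda>x. c x - c' x) y = (\<Sum>x\<in>?A. (c x - c' x) * ?e x)"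
      by (rule uf_boundary_superset[OF n fin]) auto
    also have "\<dots> = (\<Sum>x\<in>?A. c x * ?e x) - (\<Sum>x\<in>?A. c' x * ?e x)"
      by (simp only: left_diff_distrib sum_subtractf)
    also have "(\<Sum>x\<in>?A. c x * ?e x) = uf_boundary n c y"
      by (rule uf_boundary_superset[OF n fin, symmetric]) blast
    also have "(\<Sum>x\<in>?A. c' x * ?e x) = uf_boundary n c' y"
      by (rule uf_boundary_superset[OF n fin, symmetric]) blast
    finally show "uf_boundary n (\<lambda>x. c x - c' x) y = uf_boundary n c y - uf_boundary n c' y" .
  qed
qed (simp add: uf_boundary_def)

lemma (in UDBG_space) equiv_uf_homologous: "equiv (uf_cycles M d n) (uf_homologous M d n)"
proof -
  have zero: "(\<lambda>x. 0) \<in> uf_boundaries M d n"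
  proof -
    have 0: "(\<lambda>x. 0) \<in> uf_chains M d (n + 1)" unfolding uf_chains_def
      by (simp add: gt_ex)
    show ?thesis unfolding uf_boundaries_def
      by (rule image_eqI[OF _ 0]) (simp add: uf_boundary_def)
  qed
  have diff: "(\<lambda>x. a x - b x) \<in> uf_boundaries M d n"
    if "a \<in> uf_boundaries M d n" "b \<in> uf_boundaries M d n" for a b
  proof -
    from that obtain a' b' where *: "a' \<in> uf_chains M d (n + 1)" "b' \<in> uf_chains M d (n + 1)"
      "a = uf_boundary (n + 1) a'" "b = uf_boundary (n + 1) b'"
      unfolding uf_boundaries_def by blast
    have eq: "(\<lambda>x. a x - b x) = uf_boundary (n + 1) (\<lambda>x. a' x - b' x)"
      using uf_boundary_diff[OF *(1,2)] *(3,4) by simp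
    show ?thesis unfolding uf_boundaries_def eq
      by (rule imageI[OF uf_chains_diff[OF *(1,2)]])
  qed
  have minus: "(\<lambda>x. b x - a x) \<in> uf_boundaries M d n"
    if "(\<lambda>x. a x - b x) \<in> uf_boundaries M d n" for a b
    using diff[OF zero that] by simp
  have add: "(\<lambda>x. a x - e x) \<in> uf_boundaries M d n"
    if "(\<lambda>x. a x - b x) \<in> uf_boundaries M d n" "(\<lambda>x. b x - e x) \<in> uf_boundaries M d n" for a b e
    using diff[OF that(1) minus[OF that(2)]] by simp
  show ?thesis
  proof (rule equivI)
    show "uf_homologous M d n \<subseteq> uf_cycles M d n \<times> uf_cycles M d n"
      unfolding uf_homologous_def by blast
    show "refl_on (uf_cycles M d n) (uf_homologous M d n)"
      unfolding uf_homologous_def using zero by (simp add: refl_on_def)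
    show "sym (uf_homologous M d n)"
      unfolding uf_homologous_def using minus by (blast intro: symI)
    show "trans (uf_homologous M d n)"
      unfolding uf_homologous_def using add by (blast intro: transI)
  qed
qed

end

theory Submission
  imports Defs
begin

text \<open>In a non-amenable space the neighbourhoods of a finite set grow exponentially with their radius,
  at a rate that does not depend on the set. So for every \<open>N\<close> there is a radius \<open>R\<close> such that
  the \<open>R\<close>-neighbourhood of every finite set \<open>S\<close> has at least \<open>N |S|\<close> points, and Hall's marriage theorem turns this into \<open>N\<close> injections
  \<open>G\<^sub>0, \<dots>, G\<^sub>N\<^sub>-\<^sub>1\<close> of the space into itself that have pairwise disjoint images and move each point by
  at most \<open>R\<close> (\<open>nonamenable_disjoint_injections\<close>).

  A map at bounded distance from the identity acts trivially on uniformly finite homology, because the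
  prism operator gives a homotopy between its push-forward and the identity (\<open>boundary_prism_chain\<close>).
  Hence a cycle \<open>c\<close> is homologous to the average of its push-forwards along \<open>G\<^sub>0, \<dots>, G\<^sub>N\<^sub>-\<^sub>1\<close>
  (\<open>average_push_homologous\<close>). These push-forwards have pairwise disjoint supports, and each of them
  merely relocates the coefficients of \<open>c\<close>, so the average has norm at most \<open>\<parallel>c\<parallel> / N\<close>
  (\<open>linf_norm_average_push\<close>). As \<open>N\<close> is arbitrary, the semi-norm vanishes.\<close>

section \<open>Hall's theorem for infinite families of finite sets\<close>

text \<open>Rado's argument. Among the subrelations of the membership relation that still satisfy Hall's
  condition there is a minimal one, by Zorn's lemma. If some \<open>x\<close> had two partners \<open>y\<close> and \<open>z\<close> in it, then
  by minimality deleting either pair would violate Hall's condition on \<open>J \<union> {x}\<close> and \<open>K \<union> {x}\<close> for some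
  finite \<open>J\<close> and \<open>K\<close>; counting unions and intersections of the two neighbourhoods contradicts Hall's
  condition for \<open>J \<union> K \<union> {x}\<close> and \<open>J \<inter> K\<close>. So the minimal relation is a function, and Hall's condition
  for two-element sets makes it injective.\<close>

lemma Hall_infinite:
  fixes A :: "'i \<Rightarrow> 'b set"
  assumes fin: "\<And>i. i \<in> I \<Longrightarrow> finite (A i)"
    and Hall: "\<And>J. J \<subseteq> I \<Longrightarrow> finite J \<Longrightarrow> card J \<le> card (\<Union>i\<in>J. A i)"
  obtains g where "inj_on g I" "\<And>i. i \<in> I \<Longrightarrow> g i \<in> A i"
proof -
  \<comment> \<open>A minimal subrelation is what remains after a maximal set \<open>D\<close> of deletions; this turns the
    search for it into one for a maximal element under inclusion.\<close>
  define E0 where "E0 = Sigma I A"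
  define hall where "hall E \<longleftrightarrow> (\<forall>J. J \<subseteq> I \<longrightarrow> finite J \<longrightarrow> card J \<le> card (E `` J))" for E :: "('i \<times> 'b) set"
  define \<D> where "\<D> = {D. D \<subseteq> E0 \<and> hall (E0 - D)}"
  have finE0: "finite (Sigma J A)" if "J \<subseteq> I" "finite J" for J
    using that fin by blast
  have "{} \<in> \<D>"
  proof -
    have "E0 `` J = (\<Union>i\<in>J. A i)" if "J \<subseteq> I" for J
      using that by (auto simp: E0_def)
    thus ?thesis using Hall by (simp add: \<D>_def hall_def)
  qed
  moreover have "\<Union>C \<in> \<D>" if C: "C \<noteq> {}" "subset.chain \<D> C" for C
  proof -
    have sub: "C \<subseteq> \<D>" using C(2) by (simp add: subset.chain_def)
    have "card J \<le> card ((E0 - \<Union>C) `` J)" if J: "J \<subseteq> I" "finite J" for J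
    proof -
      \<comment> \<open>Only finitely many pairs lie over \<open>J\<close>, so a single member of the chain already removes
        all those that the union removes.\<close>
      have "finite (\<Union>C \<inter> Sigma J A)" using finE0[OF J] by blast
      then obtain D where D: "D \<in> C" "\<Union>C \<inter> Sigma J A \<subseteq> D"
        using finite_subset_Union_chain[of "\<Union>C \<inter> Sigma J A" C \<D>] C by blast
      have "(E0 - \<Union>C) `` J = (E0 - D) `` J"
        using D by (auto simp: E0_def)
      moreover have "hall (E0 - D)" using D(1) sub by (auto simp: \<D>_def)
      ultimately show ?thesis using J by (simp add: hall_def)
    qed
    moreover have "\<Union>C \<subseteq> E0" using sub by (auto simp: \<D>_def)
    ultimately show ?thesis by (simp add: \<D>_def hall_def)
  qed
  ultimately obtain D where D: "D \<in> \<D>" and max: "\<And>D'. D' \<in> \<D> \<Longrightarrow> D \<subseteq> D' \<Longrightarrow> D' = D"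
    using subset_Zorn_nonempty[of \<D>] by (metis empty_iff)
  define E where "E = E0 - D"
  have E: "hall E" "E \<subseteq> E0" using D by (auto simp: \<D>_def E_def)
  have hallE: "card J \<le> card (E `` J)" if "J \<subseteq> I" "finite J" for J
    using E(1) that unfolding hall_def by blast
  have finE: "finite (E `` J)" if "J \<subseteq> I" "finite J" for J
  proof (rule finite_subset)
    show "E `` J \<subseteq> snd ` Sigma J A" using E(2) that by (force simp: E0_def)
  qed (use finE0[OF that] in auto)
  have tight: "\<exists>J. J \<subseteq> I \<and> finite J \<and> x \<notin> J \<and> card (E `` J \<union> (E `` {x} - {y})) \<le> card J"
    if xy: "(x, y) \<in> E" for x y
  proof -
    have "insert (x, y) D \<notin> \<D>" using max[of "insert (x, y) D"] xy by (auto simp: E_def)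
    moreover have "insert (x, y) D \<subseteq> E0" using D xy E(2) by (auto simp: \<D>_def)
    moreover have "E0 - insert (x, y) D = E - {(x, y)}" by (auto simp: E_def)
    ultimately have "\<not> hall (E - {(x, y)})" by (auto simp: \<D>_def)
    then obtain J where J: "J \<subseteq> I" "finite J" "card ((E - {(x, y)}) `` J) < card J"
      by (auto simp: hall_def not_le)
    have x: "x \<in> J"
    proof (rule ccontr)
      assume "x \<notin> J"
      hence "(E - {(x, y)}) `` J = E `` J" by auto
      thus False using hallE[OF J(1,2)] J(3) by simp
    qed
    have "(E - {(x, y)}) `` J = E `` (J - {x}) \<union> (E `` {x} - {y})" using x by auto
    moreover have "card J = Suc (card (J - {x}))" by (rule card_Suc_Diff1[OF J(2) x, symmetric])
    ultimately show ?thesis using J by (intro exI[of _ "J - {x}"]) auto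
  qed
  have single: "y = z" if xy: "(x, y) \<in> E" and xz: "(x, z) \<in> E" for x y z
  proof (rule ccontr)
    assume "y \<noteq> z"
    have x: "x \<in> I" using xy E(2) by (auto simp: E0_def)
    obtain J where J: "J \<subseteq> I" "finite J" "x \<notin> J" "card (E `` J \<union> (E `` {x} - {y})) \<le> card J"
      using tight[OF xy] by blast
    obtain K where K: "K \<subseteq> I" "finite K" "x \<notin> K" "card (E `` K \<union> (E `` {x} - {z})) \<le> card K"
      using tight[OF xz] by blast
    let ?U = "E `` J \<union> (E `` {x} - {y})" and ?V = "E `` K \<union> (E `` {x} - {z})"
    have fx: "finite (E `` {x})" using finE[of "{x}"] x by simp
    have f: "finite ?U" "finite ?V" using finE J K fx by auto
    have "?U \<union> ?V = E `` (insert x (J \<union> K))" using \<open>y \<noteq> z\<close> by auto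
    moreover have "card (insert x (J \<union> K)) \<le> card (E `` (insert x (J \<union> K)))"
      using J K x by (intro hallE) auto
    moreover have "card (insert x (J \<union> K)) = Suc (card (J \<union> K))" using J K by simp
    ultimately have "Suc (card (J \<union> K)) \<le> card (?U \<union> ?V)" by simp
    moreover have "card (J \<inter> K) \<le> card (?U \<inter> ?V)"
    proof -
      have "card (J \<inter> K) \<le> card (E `` (J \<inter> K))"
        using J K by (intro hallE) auto
      also have "\<dots> \<le> card (?U \<inter> ?V)" using f by (intro card_mono) auto
      finally show ?thesis .
    qed
    moreover have "card (J \<union> K) + card (J \<inter> K) = card J + card K"
      using card_Un_Int[OF J(2) K(2)] by simp
    moreover have "card (?U \<union> ?V) + card (?U \<inter> ?V) = card ?U + card ?V"
      using card_Un_Int[OF f] by simp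
    ultimately show False using J(4) K(4) by linarith
  qed
  have "\<exists>y. (x, y) \<in> E" if "x \<in> I" for x
  proof -
    have "card {x} \<le> card (E `` {x})" using that by (intro hallE) auto
    hence "E `` {x} \<noteq> {}" by auto
    thus ?thesis by auto
  qed
  then obtain g where g: "\<And>x. x \<in> I \<Longrightarrow> (x, g x) \<in> E" by metis
  show thesis
  proof (rule that)
    show "g i \<in> A i" if "i \<in> I" for i using g[OF that] E(2) by (auto simp: E0_def)
    show "inj_on g I"
    proof (rule inj_onI, rule ccontr)
      fix x x' assume x: "x \<in> I" "x' \<in> I" "g x = g x'" "x \<noteq> x'"
      have "card {x, x'} \<le> card (E `` {x, x'})"
        using x by (intro hallE) auto
      moreover have "E `` {x, x'} \<subseteq> {g x}"
        using single[OF g[OF x(1)]] single[OF g[OF x(2)]] x(3) by auto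
      hence "card (E `` {x, x'}) \<le> card {g x}" by (intro card_mono) auto
      ultimately show False using x(4) by simp
    qed
  qed
qed

section \<open>Expansion in non-amenable spaces\<close>

context UDBG_space
begin

definition nbhd :: "real \<Rightarrow> 'a set \<Rightarrow> 'a set" where
  "nbhd r S = {y \<in> M. \<exists>x\<in>S. d x y \<le> r}"

lemma finite_nbhd:
  assumes "finite S" "S \<subseteq> M" "0 \<le> r"
  shows "finite (nbhd r S)"
proof (rule finite_subset)
  show "nbhd r S \<subseteq> (\<Union>x\<in>S. mball x (r + 1))"
    using assms by (force simp: nbhd_def)
  show "finite (\<Union>x\<in>S. mball x (r + 1))"
    using assms bounded_geometry[of "r + 1"] by auto
qed

lemma r_boundary_eq:
  assumes "finite S" "S \<noteq> {}" "S \<subseteq> M" "r \<ge> 0"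
  shows "r_boundary M d r S = nbhd r S - S"
proof -
  have "(INF s\<in>S. d x s) \<le> r \<longleftrightarrow> (\<exists>s\<in>S. d s x \<le> r)" for x
    using assms by (simp add: cInf_eq_Min Min_le_iff commute)
  thus ?thesis by (auto simp: r_boundary_def nbhd_def)
qed

text \<open>If no scale and constant worked, then for every \<open>n\<close> there would be a set whose \<open>(n + 1)\<close>-boundary
  is smaller than \<open>1 / (n + 1)\<close> times its size. These sets form a Folner sequence, because the \<open>r\<close>-boundary
  is contained in the \<open>(n + 1)\<close>-boundary once \<open>r \<le> n + 1\<close>. One integer \<open>n + 1\<close> thus provides both the
  scale and the inverse of the expansion constant.\<close>

lemma nonamenable_expansion:
  assumes "\<not> amenable M d"
  obtains r \<delta> :: real where "r > 0" "\<delta> > 0"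
    "\<And>S. finite S \<Longrightarrow> S \<subseteq> M \<Longrightarrow> (1 + \<delta>) * real (card S) \<le> real (card (nbhd r S))"
proof -
  have "\<exists>n::nat. \<forall>S. finite S \<longrightarrow> S \<noteq> {} \<longrightarrow> S \<subseteq> M \<longrightarrow>
      card S / Suc n \<le> card (nbhd (Suc n) S - S)"
  proof (rule ccontr)
    assume "\<not> ?thesis"
    then obtain S where S: "\<And>n. finite (S n)" "\<And>n. S n \<noteq> {}" "\<And>n. S n \<subseteq> M"
      and small: "\<And>n::nat. card (nbhd (Suc n) (S n) - S n) < card (S n) / Suc n"
      by (metis not_le)
    have "Folner_sequence M d S" unfolding Folner_sequence_def
    proof (intro conjI allI impI)
      fix r :: real assume r: "r > 0"
      show "(\<lambda>n. real (card (r_boundary M d r (S n))) / real (card (S n))) \<longlonglongrightarrow> 0"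
      proof (rule tendsto_sandwich[OF _ _ tendsto_const LIMSEQ_inverse_real_of_nat])
        have "\<forall>\<^sub>F n in sequentially. r \<le> real (Suc n)"
          using eventually_ge_at_top[of "nat \<lceil>r\<rceil>"] by eventually_elim linarith
        thus "\<forall>\<^sub>F n in sequentially. card (r_boundary M d r (S n)) / card (S n) \<le> inverse (Suc n)"
        proof eventually_elim
          case (elim n)
          have "nbhd r (S n) \<subseteq> nbhd (Suc n) (S n)"
            using elim unfolding nbhd_def by (blast intro: order_trans)
          hence "card (r_boundary M d r (S n)) \<le> card (nbhd (Suc n) (S n) - S n)"
            unfolding r_boundary_eq[OF S(1-3) less_imp_le[OF r]]
            using finite_nbhd[OF S(1) S(3)] by (intro card_mono finite_Diff) auto
          hence "real (card (r_boundary M d r (S n))) \<le> card (S n) / Suc n"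
            using small[of n] by linarith
          moreover have "card (S n) > 0" using S by (simp add: card_gt_0_iff)
          ultimately show ?case by (simp add: field_simps)
        qed
      qed simp
    qed (use S in auto)
    thus False using assms by (auto simp: amenable_def)
  qed
  then obtain n :: nat where n: "\<And>S. finite S \<Longrightarrow> S \<noteq> {} \<Longrightarrow> S \<subseteq> M \<Longrightarrow>
      card S / Suc n \<le> card (nbhd (Suc n) S - S)" by blast
  show thesis
  proof (rule that[of "Suc n" "1 / real (Suc n)"])
    fix S assume S: "finite S" "S \<subseteq> M"
    show "(1 + 1 / real (Suc n)) * real (card S) \<le> real (card (nbhd (Suc n) S))"
    proof (cases "S = {}")
      case False
      have "S \<subseteq> nbhd (Suc n) S" using S by (force simp: nbhd_def)
      moreover have "finite (nbhd (Suc n) S)" using S by (intro finite_nbhd) auto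
      ultimately have "card (nbhd (Suc n) S) = card S + card (nbhd (Suc n) S - S)"
        by (metis S(1) card_Diff_subset card_mono le_add_diff_inverse)
      thus ?thesis using n[OF S(1) False S(2)] by (simp add: algebra_simps)
    qed simp
  qed auto
qed

text \<open>An \<open>m\<close>-fold neighbourhood of radius \<open>r\<close> lies in the neighbourhood of radius \<open>m r\<close>, so expansion by
  \<open>1 + \<delta>\<close> at scale \<open>r\<close> becomes expansion by \<open>(1 + \<delta>)\<^sup>m\<close> at scale \<open>m r\<close>.\<close>

lemma nonamenable_growth:
  fixes N :: nat
  assumes "\<not> amenable M d"
  obtains R where "R > 0" "\<And>S. finite S \<Longrightarrow> S \<subseteq> M \<Longrightarrow> N * card S \<le> card (nbhd R S)"
proof -
  obtain r \<delta> :: real where r: "r > 0" "\<delta> > 0"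
    and ex: "\<And>S. finite S \<Longrightarrow> S \<subseteq> M \<Longrightarrow> (1 + \<delta>) * real (card S) \<le> real (card (nbhd r S))"
    using nonamenable_expansion[OF assms] by metis
  have iter: "(1 + \<delta>) ^ m * real (card S) \<le> card (nbhd (m * r) S)"
    if S: "finite S" "S \<subseteq> M" for S and m :: nat
  proof (induction m)
    case 0
    have "S \<subseteq> nbhd 0 S" using S by (force simp: nbhd_def)
    thus ?case using S finite_nbhd[of S 0] by (simp add: card_mono)
  next
    case (Suc m)
    let ?T = "nbhd (m * r) S"
    have T: "finite ?T" "?T \<subseteq> M" using S r finite_nbhd[of S "m * r"] by (auto simp: nbhd_def)
    have "(1 + \<delta>) ^ Suc m * card S = (1 + \<delta>) * ((1 + \<delta>) ^ m * card S)" by simp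
    also have "\<dots> \<le> (1 + \<delta>) * card ?T" using Suc r by (intro mult_left_mono) auto
    also have "\<dots> \<le> card (nbhd r ?T)" by (rule ex[OF T])
    also have "\<dots> \<le> card (nbhd (Suc m * r) S)"
    proof -
      have "nbhd r ?T \<subseteq> nbhd (Suc m * r) S"
      proof
        fix z assume "z \<in> nbhd r ?T"
        then obtain x y where "x \<in> S" "y \<in> M" "z \<in> M" "d x y \<le> m * r" "d y z \<le> r"
          by (auto simp: nbhd_def)
        moreover from this have "d x z \<le> Suc m * r"
          using triangle[of x y z] S(2) by (auto simp: algebra_simps)
        ultimately show "z \<in> nbhd (Suc m * r) S" by (auto simp: nbhd_def)
      qed
      moreover have "0 \<le> Suc m * r" using r by simp
      ultimately show ?thesis using S finite_nbhd[of S "Suc m * r"] by (simp add: card_mono)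
    qed
    finally show ?case .
  qed
  obtain m where m: "real N < (1 + \<delta>) ^ m"
    using real_arch_pow[of "1 + \<delta>" "real N"] r by auto
  also have "\<dots> \<le> (1 + \<delta>) ^ Suc m" using r by (intro power_increasing) auto
  finally have N: "real N \<le> (1 + \<delta>) ^ Suc m" by simp
  show thesis
  \<comment> \<open>\<open>Suc m\<close> instead of \<open>m\<close> keeps the radius positive when \<open>N = 0\<close>.\<close>
  proof (rule that[of "Suc m * r"])
    show "Suc m * r > 0" using r by simp
    fix S assume S: "finite S" "S \<subseteq> M"
    have "real N * card S \<le> (1 + \<delta>) ^ Suc m * card S"
      using N by (rule mult_right_mono) simp
    also have "\<dots> \<le> card (nbhd (Suc m * r) S)" by (rule iter[OF S])
    finally show "N * card S \<le> card (nbhd (Suc m * r) S)"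
      by (metis of_nat_le_iff of_nat_mult)
  qed
qed

text \<open>Injectivity of \<open>G\<close> in both arguments together says that all \<open>G i\<close> are injective and have
  pairwise disjoint images. It is a choice of distinct representatives for \<open>N\<close> copies of every ball of
  radius \<open>R\<close>: a finite set of pairs projects to a set at least \<open>1 / N\<close> times as large, and the growth of
  neighbourhoods makes up for this factor.\<close>

lemma nonamenable_disjoint_injections:
  fixes N :: nat
  assumes "\<not> amenable M d"
  obtains G R where "R > 0" "inj_on (\<lambda>(i, x). G i x) ({..<N} \<times> M)"
    "\<And>i x. i < N \<Longrightarrow> x \<in> M \<Longrightarrow> G i x \<in> M \<and> d x (G i x) \<le> R"
proof -
  obtain R where R: "R > 0" and growth: "\<And>S. finite S \<Longrightarrow> S \<subseteq> M \<Longrightarrow> N * card S \<le> card (nbhd R S)"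
    using nonamenable_growth[OF assms] by metis
  obtain g where g: "inj_on g ({..<N} \<times> M)" "\<And>p. p \<in> {..<N} \<times> M \<Longrightarrow> g p \<in> nbhd R {snd p}"
  proof (rule Hall_infinite[of "{..<N} \<times> M" "\<lambda>p. nbhd R {snd p}"])
    show "finite (nbhd R {snd p})" if "p \<in> {..<N} \<times> M" for p
      using that R by (intro finite_nbhd) auto
    fix J assume J: "J \<subseteq> {..<N} \<times> M" "finite J"
    have "card J \<le> card ({..<N} \<times> snd ` J)" using J by (intro card_mono) force+
    also have "\<dots> = N * card (snd ` J)" by (simp add: card_cartesian_product)
    also have "\<dots> \<le> card (nbhd R (snd ` J))" using J by (intro growth) auto
    also have "nbhd R (snd ` J) = (\<Union>p\<in>J. nbhd R {snd p})" by (auto simp: nbhd_def)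
    finally show "card J \<le> card (\<Union>p\<in>J. nbhd R {snd p})" .
  qed blast
  show thesis
  proof (rule that[of R "\<lambda>i x. g (i, x)"])
    show "inj_on (\<lambda>(i, x). g (i, x)) ({..<N} \<times> M)" using g(1) by simp
    show "g (i, x) \<in> M \<and> d x (g (i, x)) \<le> R" if "i < N" "x \<in> M" for i x
      using g(2)[of "(i, x)"] that by (simp add: nbhd_def)
  qed (rule R)
qed

end
section \<open>Push-forward of chains\<close>

text \<open>The supremum in the definition of chains is a maximum over a finite non-empty set; so
  bounding it amounts to bounding all distances between vertices.\<close>

lemma uf_chains_iff:
  "c \<in> uf_chains X d n \<longleftrightarrow>
     (\<forall>x. c x \<noteq> 0 \<longrightarrow> x \<in> tuples X n) \<and> (\<exists>B. \<forall>x. \<bar>c x\<bar> \<le> B) \<and>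
     (\<exists>\<rho>>0. \<forall>x. c x \<noteq> 0 \<longrightarrow> (\<forall>u\<in>set x. \<forall>v\<in>set x. d u v \<le> \<rho>))"
proof -
  have diam: "(SUP (i, j)\<in>{..n} \<times> {..n}. d (x ! i) (x ! j)) \<le> \<rho> \<longleftrightarrow>
      (\<forall>u\<in>set x. \<forall>v\<in>set x. d u v \<le> \<rho>)" if "x \<in> tuples X n" for x \<rho>
  proof -
    have "set x = (\<lambda>i. x ! i) ` {..n}"
      using that by (auto simp: tuples_def set_conv_nth less_Suc_eq_le)
    moreover have "{..n} \<times> {..n} \<noteq> {}" by auto
    ultimately show ?thesis by (subst cSup_eq_Max) auto
  qed
  have supp: "(\<forall>x. x \<notin> tuples X n \<longrightarrow> c x = 0) \<longleftrightarrow> (\<forall>x. c x \<noteq> 0 \<longrightarrow> x \<in> tuples X n)"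
    by blast
  have ctrl: "(\<forall>x\<in>tuples X n. (SUP (i, j)\<in>{..n} \<times> {..n}. d (x ! i) (x ! j)) > \<rho> \<longrightarrow> c x = 0) \<longleftrightarrow>
      (\<forall>x. c x \<noteq> 0 \<longrightarrow> (\<forall>u\<in>set x. \<forall>v\<in>set x. d u v \<le> \<rho>))"
    if "\<forall>x. c x \<noteq> 0 \<longrightarrow> x \<in> tuples X n" for \<rho>
    using that diam by (metis not_le)
  have bdd: "bdd_above (range (\<lambda>x. \<bar>c x\<bar>)) \<longleftrightarrow> (\<exists>B. \<forall>x. \<bar>c x\<bar> \<le> B)"
    by (auto simp: bdd_above_def)
  show ?thesis
    unfolding uf_chains_def mem_Collect_eq supp bdd by (intro conj_cong refl) (simp only: ctrl)
qed

lemma uf_chains_scale: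
  assumes "c \<in> uf_chains X d n"
  shows "(\<lambda>x. a * c x) \<in> uf_chains X d n"
proof -
  obtain B where "\<And>x. \<bar>c x\<bar> \<le> B" using assms by (auto simp: uf_chains_iff)
  hence "\<bar>a * c x\<bar> \<le> \<bar>a\<bar> * B" for x by (simp add: abs_mult mult_left_mono)
  thus ?thesis using assms unfolding uf_chains_iff by auto
qed

lemma uf_chains_zero: "(\<lambda>x. 0) \<in> uf_chains X d n"
  by (auto simp: uf_chains_iff intro: exI[of _ "1::real"])

lemma uf_chains_sum:
  assumes "finite J" "\<And>j. j \<in> J \<Longrightarrow> c j \<in> uf_chains X d n"
  shows "(\<lambda>x. \<Sum>j\<in>J. a j * c j x) \<in> uf_chains X d n"
  using assms
proof (induction J rule: finite_induct)
  case empty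
  show ?case by (simp add: uf_chains_zero)
next
  case (insert i J)
  have "(\<lambda>x. a i * c i x - - 1 * (\<Sum>j\<in>J. a j * c j x)) \<in> uf_chains X d n"
    using insert by (intro uf_chains_diff uf_chains_scale) auto
  thus ?case using insert by simp
qed

text \<open>Only meaningful where the fibres of \<open>\<phi>\<close> in the support of \<open>c\<close> are finite, since a sum over an
  infinite set is \<open>0\<close>.\<close>

definition push :: "('b \<Rightarrow> 'c) \<Rightarrow> ('b \<Rightarrow> real) \<Rightarrow> 'c \<Rightarrow> real" where
  "push \<phi> c y = (\<Sum>x | c x \<noteq> 0 \<and> \<phi> x = y. c x)"

text \<open>Allowing any finite superset of the fibre makes sums over the fibres of different maps or
  chains comparable.\<close>

lemma push_superset:
  assumes "finite S" "{x. c x \<noteq> 0 \<and> \<phi> x = y} \<subseteq> S"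
  shows "push \<phi> c y = (\<Sum>x\<in>S. if \<phi> x = y then c x else 0)"
proof -
  have "push \<phi> c y = (\<Sum>x | c x \<noteq> 0 \<and> \<phi> x = y. if \<phi> x = y then c x else 0)"
    unfolding push_def by (intro sum.cong) auto
  also have "\<dots> = (\<Sum>x\<in>S. if \<phi> x = y then c x else 0)"
    using assms by (intro sum.mono_neutral_left) auto
  finally show ?thesis .
qed

lemma push_nonzero: "push \<phi> c y \<noteq> 0 \<Longrightarrow> \<exists>x. c x \<noteq> 0 \<and> \<phi> x = y"
  unfolding push_def by (metis (mono_tags, lifting) mem_Collect_eq sum.not_neutral_contains_not_neutral)

lemma push_zero [simp]: "push \<phi> (\<lambda>x. 0) y = 0"
  by (simp add: push_def)

lemma push_cong:
  assumes "c \<in> uf_chains X d n" "\<And>x. x \<in> tuples X n \<Longrightarrow> \<phi> x = \<psi> x"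
  shows "push \<phi> c y = push \<psi> c y"
proof -
  have "{x. c x \<noteq> 0 \<and> \<phi> x = y} = {x. c x \<noteq> 0 \<and> \<psi> x = y}"
    using assms by (auto simp: uf_chains_iff)
  thus ?thesis by (simp add: push_def)
qed

lemma push_id:
  assumes "c \<in> uf_chains X d n" "\<And>x. x \<in> tuples X n \<Longrightarrow> \<phi> x = x"
  shows "push \<phi> c y = c y"
proof -
  have "push \<phi> c y = push (\<lambda>x. x) c y" using assms by (rule push_cong)
  also have "\<dots> = c y" by (subst push_superset[of "{y}"]) auto
  finally show ?thesis .
qed

context UDBG_space
begin

text \<open>A map of simplices is controlled if every new vertex is close to an old one. On the support of a
  uniformly finite chain such a map has uniformly bounded finite fibres, which makes \<^const>\<open>push\<close> well
  behaved. Faces, prisms and \<open>map f\<close> for \<open>f\<close> near the identity are all of this kind.\<close>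

definition controlled :: "nat \<Rightarrow> nat \<Rightarrow> real \<Rightarrow> ('a list \<Rightarrow> 'a list) \<Rightarrow> bool" where
  "controlled n m R \<phi> \<longleftrightarrow> (\<forall>x\<in>tuples M n. \<phi> x \<in> tuples M m \<and> (\<forall>v\<in>set (\<phi> x). \<exists>u\<in>set x. d u v \<le> R))"

lemma controlled_comp:
  assumes "controlled n m R \<phi>" "controlled m l S \<psi>"
  shows "controlled n l (R + S) (\<psi> \<circ> \<phi>)"
  unfolding controlled_def
proof (intro ballI conjI)
  fix x assume x: "x \<in> tuples M n"
  have \<phi>: "\<phi> x \<in> tuples M m" using assms(1) x by (simp add: controlled_def)
  thus "(\<psi> \<circ> \<phi>) x \<in> tuples M l" using assms(2) by (simp add: controlled_def)
  fix w assume w: "w \<in> set ((\<psi> \<circ> \<phi>) x)"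
  then obtain v where v: "v \<in> set (\<phi> x)" "d v w \<le> S"
    using assms(2) \<phi> by (force simp: controlled_def)
  then obtain u where u: "u \<in> set x" "d u v \<le> R"
    using assms(1) x by (force simp: controlled_def)
  have "w \<in> M" using w \<open>(\<psi> \<circ> \<phi>) x \<in> tuples M l\<close> by (auto simp: tuples_def)
  hence "d u w \<le> d u v + d v w"
    using u v x \<phi> by (intro triangle) (auto simp: tuples_def)
  thus "\<exists>u\<in>set x. d u w \<le> R + S" using u v by force
qed

text \<open>Every simplex in the fibre over \<open>y\<close> has a vertex near the first vertex of \<open>y\<close> and diameter at most
  \<open>\<rho>\<close>, so it has all its vertices in one ball around that point, and the size of such a ball is bounded
  independently of \<open>y\<close>.\<close>

lemma controlled_fibres:
  assumes c: "c \<in> uf_chains M d n" and \<phi>: "controlled n m R \<phi>"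
  obtains K :: nat where "\<And>y. finite {x. c x \<noteq> 0 \<and> \<phi> x = y}" "\<And>y. card {x. c x \<noteq> 0 \<and> \<phi> x = y} \<le> K"
proof -
  obtain \<rho> where \<rho>: "\<rho> > 0" and supp: "\<And>x. c x \<noteq> 0 \<Longrightarrow> x \<in> tuples M n"
    and diam: "\<And>x u v. c x \<noteq> 0 \<Longrightarrow> u \<in> set x \<Longrightarrow> v \<in> set x \<Longrightarrow> d u v \<le> \<rho>"
    using c by (auto simp: uf_chains_iff)
  define r where "r = \<rho> + \<bar>R\<bar> + 1"
  obtain K where K: "\<And>p. p \<in> M \<Longrightarrow> finite (mball p r) \<and> real (card (mball p r)) < K"
    using bounded_geometry[of r] \<rho> by (auto simp: r_def add_pos_nonneg)
  let ?K = "nat \<lceil>K\<rceil> ^ (n + 1)"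
  have "finite {x. c x \<noteq> 0 \<and> \<phi> x = y} \<and> card {x. c x \<noteq> 0 \<and> \<phi> x = y} \<le> ?K" for y
  proof (cases "{x. c x \<noteq> 0 \<and> \<phi> x = y} = {}")
    case False
    then obtain x0 where "c x0 \<noteq> 0" "\<phi> x0 = y" by blast
    hence "y \<in> tuples M m" using supp \<phi> by (auto simp: controlled_def)
    hence y: "hd y \<in> set y" "hd y \<in> M" by (cases y; auto simp: tuples_def)+
    let ?L = "{x. set x \<subseteq> mball (hd y) r \<and> length x = n + 1}"
    have fin: "finite (mball (hd y) r)" using K y by blast
    have "{x. c x \<noteq> 0 \<and> \<phi> x = y} \<subseteq> ?L"
    proof safe
      fix x v assume x: "c x \<noteq> 0" "y = \<phi> x" and v: "v \<in> set x"
      obtain u where u: "u \<in> set x" "d u (hd y) \<le> R"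
        using \<phi> supp[OF x(1)] y x(2) by (auto simp: controlled_def)
      have uv: "u \<in> M" "v \<in> M" using supp[OF x(1)] u v by (auto simp: tuples_def)
      have "d (hd y) v \<le> d (hd y) u + d u v" using uv y by (intro triangle)
      also have "\<dots> \<le> R + \<rho>" using u diam[OF x(1) u(1) v] by (simp add: commute)
      also have "\<dots> < r" by (simp add: r_def)
      finally show "v \<in> mball (hd (\<phi> x)) r" using uv y x(2) by auto
    next
      fix x assume "c x \<noteq> 0"
      thus "length x = n + 1" using supp by (auto simp: tuples_def)
    qed
    moreover have "finite ?L" by (rule finite_lists_length_eq[OF fin])
    moreover have "card ?L \<le> ?K"
    proof -
      have "card (mball (hd y) r) \<le> nat \<lceil>K\<rceil>" using K[OF y(2)] by linarith
      thus ?thesis unfolding card_lists_length_eq[OF fin] by (rule power_mono) simp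
    qed
    ultimately show ?thesis by (meson card_mono finite_subset order_trans)
  next
    case True
    show ?thesis unfolding True by simp
  qed
  thus thesis using that by blast
qed

lemma finite_fibre:
  assumes "c \<in> uf_chains M d n" "controlled n m R \<phi>"
  shows "finite {x. c x \<noteq> 0 \<and> \<phi> x = y}"
  using controlled_fibres[OF assms] by metis

lemma push_chain:
  assumes c: "c \<in> uf_chains M d n" and \<phi>: "controlled n m R \<phi>"
  shows "push \<phi> c \<in> uf_chains M d m"
proof -
  obtain \<rho> where \<rho>: "\<rho> > 0" and supp: "\<And>x. c x \<noteq> 0 \<Longrightarrow> x \<in> tuples M n"
    and diam: "\<And>x u v. c x \<noteq> 0 \<Longrightarrow> u \<in> set x \<Longrightarrow> v \<in> set x \<Longrightarrow> d u v \<le> \<rho>"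
    using c by (auto simp: uf_chains_iff)
  obtain B where B: "\<And>x. \<bar>c x\<bar> \<le> B" using c by (auto simp: uf_chains_iff)
  obtain K where K: "\<And>y. card {x. c x \<noteq> 0 \<and> \<phi> x = y} \<le> K"
    using controlled_fibres[OF c \<phi>] by metis
  have "B \<ge> 0" using B[of undefined] by linarith
  have bound: "\<bar>push \<phi> c y\<bar> \<le> K * B" for y
  proof -
    have "\<bar>push \<phi> c y\<bar> \<le> (\<Sum>x | c x \<noteq> 0 \<and> \<phi> x = y. \<bar>c x\<bar>)"
      unfolding push_def by (rule sum_abs)
    also have "\<dots> \<le> card {x. c x \<noteq> 0 \<and> \<phi> x = y} * B"
      using B by (intro sum_bounded_above)
    also have "\<dots> \<le> K * B" using K \<open>B \<ge> 0\<close> by (intro mult_right_mono) auto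
    finally show ?thesis .
  qed
  have tup: "y \<in> tuples M m" if "push \<phi> c y \<noteq> 0" for y
    using push_nonzero[OF that] supp \<phi> by (auto simp: controlled_def)
  have "d v w \<le> \<rho> + 2 * \<bar>R\<bar>" if nz: "push \<phi> c y \<noteq> 0" and vw: "v \<in> set y" "w \<in> set y" for y v w
  proof -
    obtain x where x: "c x \<noteq> 0" "\<phi> x = y" using push_nonzero[OF nz] by blast
    obtain u u' where u: "u \<in> set x" "d u v \<le> R" "u' \<in> set x" "d u' w \<le> R"
      using \<phi> supp[OF x(1)] vw x(2) unfolding controlled_def by blast
    have M: "v \<in> M" "w \<in> M" "u \<in> M" "u' \<in> M"
      using tup[OF nz] vw supp[OF x(1)] u by (auto simp: tuples_def)
    have "d v w \<le> d v u + d u w" "d u w \<le> d u u' + d u' w" using M by (auto intro: triangle)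
    thus ?thesis using u diam[OF x(1) u(1) u(3)] commute[of u v] by linarith
  qed
  moreover have "\<rho> + 2 * \<bar>R\<bar> > 0" using \<rho> by linarith
  ultimately show ?thesis unfolding uf_chains_iff using tup bound by blast
qed

lemma push_push:
  assumes c: "c \<in> uf_chains M d n" and \<phi>: "controlled n m R \<phi>" and \<psi>: "controlled m l S \<psi>"
  shows "push \<psi> (push \<phi> c) y = push (\<psi> \<circ> \<phi>) c y"
proof -
  define A where "A = {x. c x \<noteq> 0 \<and> (\<psi> \<circ> \<phi>) x = y}"
  have A: "finite A" unfolding A_def by (rule finite_fibre[OF c controlled_comp[OF \<phi> \<psi>]])
  have "{z. push \<phi> c z \<noteq> 0 \<and> \<psi> z = y} \<subseteq> \<phi> ` A"
    using push_nonzero[of \<phi> c] by (force simp: A_def)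
  hence "push \<psi> (push \<phi> c) y = (\<Sum>z\<in>\<phi> ` A. if \<psi> z = y then push \<phi> c z else 0)"
    using A by (intro push_superset) auto
  also have "\<dots> = (\<Sum>z\<in>\<phi> ` A. \<Sum>x\<in>{x \<in> A. \<phi> x = z}. c x)"
  proof (rule sum.cong[OF refl])
    fix z assume z: "z \<in> \<phi> ` A"
    hence "{x. c x \<noteq> 0 \<and> \<phi> x = z} = {x \<in> A. \<phi> x = z}" by (auto simp: A_def)
    thus "(if \<psi> z = y then push \<phi> c z else 0) = (\<Sum>x\<in>{x \<in> A. \<phi> x = z}. c x)"
      using z by (auto simp: push_def A_def)
  qed
  also have "\<dots> = sum c A" using A by (intro sum.group) auto
  finally show ?thesis by (simp add: push_def A_def)
qed

lemma push_sum:
  assumes J: "finite J" and c: "\<And>j. j \<in> J \<Longrightarrow> c j \<in> uf_chains M d n" and \<phi>: "controlled n m R \<phi>"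
  shows "push \<phi> (\<lambda>x. \<Sum>j\<in>J. a j * c j x) y = (\<Sum>j\<in>J. a j * push \<phi> (c j) y)"
proof -
  define S where "S = (\<Union>j\<in>J. {x. c j x \<noteq> 0 \<and> \<phi> x = y})"
  have S: "finite S" unfolding S_def using J finite_fibre[OF c \<phi>] by blast
  have "push \<phi> (\<lambda>x. \<Sum>j\<in>J. a j * c j x) y
      = (\<Sum>x\<in>S. if \<phi> x = y then \<Sum>j\<in>J. a j * c j x else 0)"
  proof (rule push_superset[OF S])
    show "{x. (\<Sum>j\<in>J. a j * c j x) \<noteq> 0 \<and> \<phi> x = y} \<subseteq> S"
    proof safe
      fix x assume "(\<Sum>j\<in>J. a j * c j x) \<noteq> 0" "y = \<phi> x"
      then obtain j where "j \<in> J" "a j * c j x \<noteq> 0"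
        using sum.not_neutral_contains_not_neutral by blast
      thus "x \<in> S" using \<open>y = \<phi> x\<close> by (auto simp: S_def)
    qed
  qed
  also have "\<dots> = (\<Sum>x\<in>S. \<Sum>j\<in>J. a j * (if \<phi> x = y then c j x else 0))"
    by (intro sum.cong) auto
  also have "\<dots> = (\<Sum>j\<in>J. a j * (\<Sum>x\<in>S. if \<phi> x = y then c j x else 0))"
    by (subst sum.swap) (simp add: sum_distrib_left)
  also have "\<dots> = (\<Sum>j\<in>J. a j * push \<phi> (c j) y)"
  proof (rule sum.cong[OF refl])
    fix j assume "j \<in> J"
    hence "push \<phi> (c j) y = (\<Sum>x\<in>S. if \<phi> x = y then c j x else 0)"
      by (intro push_superset[OF S]) (auto simp: S_def)
    thus "a j * (\<Sum>x\<in>S. if \<phi> x = y then c j x else 0) = a j * push \<phi> (c j) y" by simp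
  qed
  finally show ?thesis .
qed

lemma controlled_face:
  assumes "j \<le> Suc n"
  shows "controlled (Suc n) n 0 (face j)"
  unfolding controlled_def
proof (intro ballI conjI)
  fix x assume x: "x \<in> tuples M (Suc n)"
  have sub: "set (face j x) \<subseteq> set x" by (auto simp: face_def dest: in_set_takeD in_set_dropD)
  thus "face j x \<in> tuples M n" using x assms by (auto simp: tuples_def face_def)
  fix v assume "v \<in> set (face j x)"
  hence "v \<in> set x" using sub by blast
  moreover have "v \<in> M" using \<open>v \<in> set x\<close> x by (auto simp: tuples_def)
  ultimately show "\<exists>u\<in>set x. d u v \<le> 0" by (intro bexI[of _ v]) auto
qed

text \<open>This reduces all computations with boundaries to compositions of maps of simplices, by
  \<open>push_push\<close>.\<close>

lemma uf_boundary_push: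
  assumes c: "c \<in> uf_chains M d (Suc n)"
  shows "uf_boundary (Suc n) c y = (\<Sum>j\<le>Suc n. (-1) ^ j * push (face j) c y)"
proof -
  define S where "S = {x. c x \<noteq> 0 \<and> (\<exists>j\<le>Suc n. face j x = y)}"
  have S: "finite S" unfolding S_def using finite_cofaces[OF c] by simp
  have "uf_boundary (Suc n) c y = (\<Sum>x\<in>S. c x * (\<Sum>j | j \<le> Suc n \<and> face j x = y. (-1) ^ j))"
    by (rule uf_boundary_superset[OF _ S]) (auto simp: S_def)
  also have "\<dots> = (\<Sum>x\<in>S. \<Sum>j\<le>Suc n. (-1) ^ j * (if face j x = y then c x else 0))"
  proof (rule sum.cong[OF refl])
    fix x
    have "{j. j \<le> Suc n \<and> face j x = y} = {j \<in> {..Suc n}. face j x = y}" by auto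
    hence "c x * (\<Sum>j | j \<le> Suc n \<and> face j x = y. (-1) ^ j) =
        c x * (\<Sum>j\<le>Suc n. if face j x = y then (-1) ^ j else 0)"
      by (simp only: sum.inter_filter[OF finite_atMost])
    also have "\<dots> = (\<Sum>j\<le>Suc n. (-1) ^ j * (if face j x = y then c x else 0))"
      unfolding sum_distrib_left by (intro sum.cong) auto
    finally show "c x * (\<Sum>j | j \<le> Suc n \<and> face j x = y. (-1) ^ j) = \<dots>" .
  qed
  also have "\<dots> = (\<Sum>j\<le>Suc n. (-1) ^ j * (\<Sum>x\<in>S. if face j x = y then c x else 0))"
    by (subst sum.swap) (simp only: sum_distrib_left)
  also have "\<dots> = (\<Sum>j\<le>Suc n. (-1) ^ j * push (face j) c y)"
  proof (rule sum.cong[OF refl])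
    fix j assume "j \<in> {..Suc n}"
    hence "push (face j) c y = (\<Sum>x\<in>S. if face j x = y then c x else 0)"
      by (intro push_superset[OF S]) (auto simp: S_def)
    thus "(-1) ^ j * (\<Sum>x\<in>S. if face j x = y then c x else 0) = (-1) ^ j * push (face j) c y"
      by simp
  qed
  finally show ?thesis .
qed

lemma uf_boundary_sum:
  assumes J: "finite J" and c: "\<And>j. j \<in> J \<Longrightarrow> c j \<in> uf_chains M d n"
  shows "uf_boundary n (\<lambda>x. \<Sum>j\<in>J. a j * c j x) y = (\<Sum>j\<in>J. a j * uf_boundary n (c j) y)"
proof (cases n)
  case 0
  thus ?thesis by (simp add: uf_boundary_def)
next
  case (Suc k)
  have "uf_boundary n (\<lambda>x. \<Sum>j\<in>J. a j * c j x) y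
      = (\<Sum>i\<le>n. (-1) ^ i * (\<Sum>j\<in>J. a j * push (face i) (c j) y))"
  proof -
    have "push (face i) (\<lambda>x. \<Sum>j\<in>J. a j * c j x) y = (\<Sum>j\<in>J. a j * push (face i) (c j) y)"
      if "i \<le> Suc k" for i
      using c unfolding Suc by (rule push_sum[OF J _ controlled_face[OF that]])
    thus ?thesis
      using uf_chains_sum[OF J c, where a = a] unfolding Suc
      by (subst uf_boundary_push) (auto intro!: sum.cong simp del: sum.atMost_Suc)
  qed
  also have "\<dots> = (\<Sum>j\<in>J. a j * (\<Sum>i\<le>n. (-1) ^ i * push (face i) (c j) y))"
    unfolding sum_distrib_left by (subst sum.swap) (simp only: mult.left_commute)
  also have "\<dots> = (\<Sum>j\<in>J. a j * uf_boundary n (c j) y)"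
    using c by (intro sum.cong) (simp_all add: Suc uf_boundary_push)
  finally show ?thesis .
qed

end

section \<open>The prism homotopy\<close>

text \<open>For a simplex \<open>(x\<^sub>0, \<dots>, x\<^sub>n)\<close> this is \<open>(x\<^sub>0, \<dots>, x\<^sub>i, f x\<^sub>i, \<dots>, f x\<^sub>n)\<close>.\<close>

definition prism :: "('a \<Rightarrow> 'a) \<Rightarrow> nat \<Rightarrow> 'a list \<Rightarrow> 'a list" where
  "prism f i x = take (Suc i) x @ map f (drop i x)"

lemma length_prism: "i < length x \<Longrightarrow> length (prism f i x) = Suc (length x)"
  by (simp add: prism_def)

lemma nth_prism:
  assumes "i < length x" "m \<le> length x"
  shows "prism f i x ! m = (if m \<le> i then x ! m else f (x ! (m - 1)))"
  using assms by (simp add: prism_def nth_append min_absorb2 Suc_le_eq less_Suc_eq_le)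

lemma length_face: "j < length x \<Longrightarrow> length (face j x) = length x - 1"
  by (simp add: face_def)

lemma nth_face:
  assumes "j < length x" "m < length x - 1"
  shows "face j x ! m = (if m < j then x ! m else x ! Suc m)"
  using assms by (auto simp: face_def nth_append min_def)

lemma face_prism_lower:
  assumes "length x = Suc k" "i < k" "j \<le> i"
  shows "face j (prism f (Suc i) x) = prism f i (face j x)"
  using assms by (intro nth_equalityI) (auto simp: length_prism length_face nth_prism nth_face)

lemma face_prism_upper:
  assumes "length x = Suc k" "i < k" "i < j" "j \<le> k"
  shows "face (Suc j) (prism f i x) = prism f i (face j x)"
  using assms by (intro nth_equalityI) (auto simp: length_prism length_face nth_prism nth_face)

lemma face_prism_diag:
  assumes "length x = Suc k" "i < k"
  shows "face (Suc i) (prism f i x) = face (Suc i) (prism f (Suc i) x)"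
  using assms by (intro nth_equalityI) (auto simp: length_prism length_face nth_prism nth_face)

lemma face_prism_first:
  assumes "length x = Suc k"
  shows "face 0 (prism f 0 x) = map f x"
  using assms by (intro nth_equalityI) (auto simp: length_prism length_face nth_prism nth_face)

lemma face_prism_last:
  assumes "length x = Suc k"
  shows "face (Suc k) (prism f k x) = x"
  using assms by (intro nth_equalityI) (auto simp: length_prism length_face nth_prism nth_face)

lemma face_map: "face j (map f x) = map f (face j x)"
  by (simp add: face_def take_map drop_map)

text \<open>The signed count behind the prism homotopy. Here \<open>a i j\<close> stands for the \<open>j\<close>-th face of the \<open>i\<close>-th
  prism and \<open>b i j\<close> for the \<open>i\<close>-th prism over the \<open>j\<close>-th face. Off the two diagonals \<open>j = i\<close> and
  \<open>j = i + 1\<close>, each \<open>a\<close> is a \<open>b\<close> with one index lowered, hence with the opposite sign; the two diagonals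
  telescope.\<close>

lemma prism_sign_sum:
  fixes a b :: "nat \<Rightarrow> nat \<Rightarrow> real"
  assumes lower: "\<And>i j. i < k \<Longrightarrow> j \<le> i \<Longrightarrow> a (Suc i) j = b i j"
    and upper: "\<And>i j. i < k \<Longrightarrow> i < j \<Longrightarrow> j \<le> k \<Longrightarrow> a i (Suc j) = b i j"
    and diag: "\<And>i. i < k \<Longrightarrow> a i (Suc i) = a (Suc i) (Suc i)"
  shows "(\<Sum>i\<le>k. \<Sum>j\<le>Suc k. (-1) ^ (i + j) * a i j) =
     a 0 0 - a k (Suc k) - (\<Sum>i<k. \<Sum>j\<le>k. (-1) ^ (i + j) * b i j)"
proof -
  have row: "(\<Sum>j\<le>Suc k. (-1) ^ (i + j) * a i j) =
      (\<Sum>j<i. (-1) ^ (i + j) * a i j) + (a i i - a i (Suc i))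
      - (\<Sum>j\<in>{i<..k}. (-1) ^ (i + j) * a i (Suc j))" if "i \<le> k" for i
  proof -
    have "{..Suc k} = {..<i} \<union> ({i, Suc i} \<union> Suc ` {i<..k})"
      using that by (auto simp: image_iff) (metis Suc_le_mono Suc_pred' greaterThanAtMost_iff
        less_Suc_eq_0_disj nat_neq_iff not_less_eq not_less_zero)
    hence "(\<Sum>j\<le>Suc k. (-1) ^ (i + j) * a i j) =
        (\<Sum>j<i. (-1) ^ (i + j) * a i j) + ((\<Sum>j\<in>{i, Suc i}. (-1) ^ (i + j) * a i j) +
        (\<Sum>j\<in>Suc ` {i<..k}. (-1) ^ (i + j) * a i j))"
      by (simp only:) (subst sum.union_disjoint; (subst sum.union_disjoint)?; auto)
    moreover have "(\<Sum>j\<in>{i, Suc i}. (-1) ^ (i + j) * a i j) = a i i - a i (Suc i)"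
      by simp
    moreover have "(\<Sum>j\<in>Suc ` {i<..k}. (-1) ^ (i + j) * a i j) =
        - (\<Sum>j\<in>{i<..k}. (-1) ^ (i + j) * a i (Suc j))"
      by (subst sum.reindex) (simp_all add: sum_negf)
    ultimately show ?thesis by linarith
  qed
  have low: "(\<Sum>i\<le>k. \<Sum>j<i. (-1) ^ (i + j) * a i j) = - (\<Sum>i<k. \<Sum>j\<le>i. (-1) ^ (i + j) * b i j)"
  proof -
    have "(\<Sum>i\<le>k. \<Sum>j<i. (-1) ^ (i + j) * a i j) =
        (\<Sum>i<k. \<Sum>j<Suc i. (-1) ^ (Suc i + j) * a (Suc i) j)"
      by (subst sum.atMost_shift) simp
    also have "\<dots> = (\<Sum>i<k. - (\<Sum>j\<le>i. (-1) ^ (i + j) * b i j))"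
      unfolding lessThan_Suc_atMost sum_negf[symmetric]
      by (intro sum.cong refl) (auto simp: lower)
    finally show ?thesis by (simp only: sum_negf)
  qed
  have up: "(\<Sum>i\<le>k. \<Sum>j\<in>{i<..k}. (-1) ^ (i + j) * a i (Suc j)) =
      (\<Sum>i<k. \<Sum>j\<in>{i<..k}. (-1) ^ (i + j) * b i j)"
  proof -
    have "(\<Sum>i\<le>k. \<Sum>j\<in>{i<..k}. (-1) ^ (i + j) * a i (Suc j)) =
        (\<Sum>i<k. \<Sum>j\<in>{i<..k}. (-1) ^ (i + j) * a i (Suc j))"
      by (simp add: lessThan_Suc_atMost[symmetric])
    thus ?thesis by (simp add: upper)
  qed
  have "(\<Sum>i\<le>k. a i i - a i (Suc i)) = (\<Sum>i<k. a i i - a (Suc i) (Suc i)) + (a k k - a k (Suc k))"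
    by (simp add: lessThan_Suc_atMost[symmetric] diag)
  hence tele: "(\<Sum>i\<le>k. a i i - a i (Suc i)) = a 0 0 - a k (Suc k)"
    using sum_lessThan_telescope'[of "\<lambda>i. a i i" k] by simp
  have split: "(\<Sum>j\<le>i. (-1) ^ (i + j) * b i j) + (\<Sum>j\<in>{i<..k}. (-1) ^ (i + j) * b i j) =
      (\<Sum>j\<le>k. (-1) ^ (i + j) * b i j)" if "i < k" for i
  proof -
    have "{..k} = {..i} \<union> {i<..k}" using that by auto
    thus ?thesis by (simp only:) (subst sum.union_disjoint; auto)
  qed
  have "(\<Sum>i\<le>k. \<Sum>j\<le>Suc k. (-1) ^ (i + j) * a i j) =
      (\<Sum>i\<le>k. \<Sum>j<i. (-1) ^ (i + j) * a i j) + (\<Sum>i\<le>k. a i i - a i (Suc i))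
      - (\<Sum>i\<le>k. \<Sum>j\<in>{i<..k}. (-1) ^ (i + j) * a i (Suc j))"
    unfolding sum.distrib[symmetric] sum_subtractf[symmetric]
    by (intro sum.cong refl) (simp only: row atMost_iff)
  also have "\<dots> = a 0 0 - a k (Suc k) - (\<Sum>i<k. (\<Sum>j\<le>i. (-1) ^ (i + j) * b i j) +
      (\<Sum>j\<in>{i<..k}. (-1) ^ (i + j) * b i j))"
    unfolding low up tele by (simp only: sum.distrib)
  finally show ?thesis using split by simp
qed

context UDBG_space
begin

lemma controlled_prism:
  assumes f: "\<And>x. x \<in> M \<Longrightarrow> f x \<in> M \<and> d x (f x) \<le> R" and "0 \<le> R" "i \<le> n"
  shows "controlled n (Suc n) R (prism f i)"
  unfolding controlled_def
proof (intro ballI conjI)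
  fix x assume x: "x \<in> tuples M n"
  have sub: "set (prism f i x) \<subseteq> set x \<union> f ` set x"
    by (auto simp: prism_def dest: in_set_takeD in_set_dropD)
  show "prism f i x \<in> tuples M (Suc n)"
    using x assms sub by (auto simp: tuples_def length_prism)
  fix v assume "v \<in> set (prism f i x)"
  thus "\<exists>u\<in>set x. d u v \<le> R" using sub x f \<open>0 \<le> R\<close> by (force simp: tuples_def)
qed

lemma controlled_map:
  assumes "\<And>x. x \<in> M \<Longrightarrow> f x \<in> M \<and> d x (f x) \<le> R"
  shows "controlled n n R (map f)"
  using assms by (force simp: controlled_def tuples_def)

text \<open>Push-forward along \<open>map f\<close> commutes with the boundary, since \<open>map f\<close> commutes with faces.\<close>

lemma push_map_cycle:
  assumes c: "c \<in> uf_cycles M d n" and f: "\<And>x. x \<in> M \<Longrightarrow> f x \<in> M \<and> d x (f x) \<le> R"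
  shows "push (map f) c \<in> uf_cycles M d n"
proof -
  have ch: "c \<in> uf_chains M d n" and bd: "uf_boundary n c = (\<lambda>y. 0)"
    using c by (auto simp: uf_cycles_def)
  have fc: "controlled m m R (map f)" for m by (rule controlled_map[OF f])
  have chain: "push (map f) c \<in> uf_chains M d n" by (rule push_chain[OF ch fc])
  have "uf_boundary n (push (map f) c) y = 0" for y
  proof (cases n)
    case (Suc k)
    have "uf_boundary n (push (map f) c) y
        = (\<Sum>j\<le>Suc k. (-1) ^ j * push (face j) (push (map f) c) y)"
      using chain by (simp only: Suc uf_boundary_push)
    also have "\<dots> = (\<Sum>j\<le>Suc k. (-1) ^ j * push (map f) (push (face j) c) y)"
    proof (rule sum.cong[OF refl])
      fix j assume "j \<in> {..Suc k}"
      hence j: "controlled (Suc k) k 0 (face j)" by (intro controlled_face) simp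
      have "face j \<circ> map f = map f \<circ> face j" by (auto simp: face_map)
      thus "(-1) ^ j * push (face j) (push (map f) c) y =
          (-1) ^ j * push (map f) (push (face j) c) y"
        using push_push[OF ch[unfolded Suc] fc j] push_push[OF ch[unfolded Suc] j fc] by simp
    qed
    also have "\<dots> = push (map f) (\<lambda>x. \<Sum>j\<le>Suc k. (-1) ^ j * push (face j) c x) y"
      using ch unfolding Suc
      by (intro push_sum[symmetric, OF _ _ fc] push_chain[OF _ controlled_face]) auto
    also have "(\<lambda>x. \<Sum>j\<le>Suc k. (-1) ^ j * push (face j) c x) = (\<lambda>x. 0)"
      using bd ch unfolding Suc by (simp only: uf_boundary_push[symmetric])
    finally show ?thesis by simp
  qed (simp add: uf_boundary_def)
  thus ?thesis using chain by (auto simp: uf_cycles_def)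
qed

definition prism_chain :: "nat \<Rightarrow> ('a \<Rightarrow> 'a) \<Rightarrow> ('a list \<Rightarrow> real) \<Rightarrow> 'a list \<Rightarrow> real" where
  "prism_chain n f c = (\<lambda>x. \<Sum>i\<le>n. (-1) ^ i * push (prism f i) c x)"

lemma prism_chain_in:
  assumes c: "c \<in> uf_chains M d n" and f: "\<And>x. x \<in> M \<Longrightarrow> f x \<in> M \<and> d x (f x) \<le> R" "0 \<le> R"
  shows "prism_chain n f c \<in> uf_chains M d (Suc n)"
  unfolding prism_chain_def
  by (intro uf_chains_sum push_chain[OF c controlled_prism[OF f]]) auto

text \<open>The general homotopy formula has a further term, the prism operator applied to \<open>\<partial>c\<close>, which vanishes
  for a cycle.\<close>

lemma boundary_prism_chain:
  assumes c: "c \<in> uf_cycles M d k" and f: "\<And>x. x \<in> M \<Longrightarrow> f x \<in> M \<and> d x (f x) \<le> R" "0 \<le> R"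
  shows "uf_boundary (Suc k) (prism_chain k f c) y = push (map f) c y - c y"
proof -
  have ch: "c \<in> uf_chains M d k" and bd: "uf_boundary k c = (\<lambda>y. 0)"
    using c by (auto simp: uf_cycles_def)
  have P: "controlled n (Suc n) R (prism f i)" if "i \<le> n" for n i
    by (rule controlled_prism[OF f that])
  define a where "a i j = push (face j \<circ> prism f i) c y" for i j
  define b where "b i j = push (prism f i \<circ> face j) c y" for i j
  have len: "length x = Suc k" if "x \<in> tuples M k" for x using that by (simp add: tuples_def)
  have "uf_boundary (Suc k) (prism_chain k f c) y =
      (\<Sum>i\<le>k. (-1) ^ i * uf_boundary (Suc k) (push (prism f i) c) y)"
    unfolding prism_chain_def by (intro uf_boundary_sum push_chain[OF ch P]) auto
  also have "\<dots> = (\<Sum>i\<le>k. \<Sum>j\<le>Suc k. (-1) ^ (i + j) * a i j)"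
  proof (rule sum.cong[OF refl])
    fix i assume "i \<in> {..k}"
    hence i: "controlled k (Suc k) R (prism f i)" by (intro P) simp
    show "(-1) ^ i * uf_boundary (Suc k) (push (prism f i) c) y
        = (\<Sum>j\<le>Suc k. (-1) ^ (i + j) * a i j)"
      unfolding uf_boundary_push[OF push_chain[OF ch i]] sum_distrib_left a_def
      by (intro sum.cong refl) (simp add: push_push[OF ch i controlled_face] power_add)
  qed
  also have "\<dots> = a 0 0 - a k (Suc k) - (\<Sum>i<k. \<Sum>j\<le>k. (-1) ^ (i + j) * b i j)"
  proof (rule prism_sign_sum)
    show "a (Suc i) j = b i j" if "i < k" "j \<le> i" for i j
      unfolding a_def b_def
      by (rule push_cong[OF ch]) (simp add: face_prism_lower[OF len that])
    show "a i (Suc j) = b i j" if "i < k" "i < j" "j \<le> k" for i j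
      unfolding a_def b_def
      by (rule push_cong[OF ch]) (simp add: face_prism_upper[OF len that])
    show "a i (Suc i) = a (Suc i) (Suc i)" if "i < k" for i
      unfolding a_def
      by (rule push_cong[OF ch]) (simp add: face_prism_diag[OF len that])
  qed
  also have "(\<Sum>i<k. \<Sum>j\<le>k. (-1) ^ (i + j) * b i j) = 0"
  \<comment> \<open>For \<open>k = 0\<close> the sum is empty; otherwise it collects the prisms over the faces of \<open>c\<close>,
    that is, over \<open>\<partial>c = 0\<close>.\<close>
  proof (cases k)
    case (Suc m)
    have "(\<Sum>j\<le>k. (-1) ^ (i + j) * b i j) = 0" if i: "i < k" for i
    proof -
      have iP: "controlled m (Suc m) R (prism f i)" using i Suc by (intro P) simp
      have "(\<Sum>j\<le>k. (-1) ^ (i + j) * b i j) =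
          (-1) ^ i * (\<Sum>j\<le>Suc m. (-1) ^ j * push (prism f i) (push (face j) c) y)"
        unfolding sum_distrib_left Suc b_def
        using push_push[OF ch[unfolded Suc] controlled_face iP]
        by (intro sum.cong) (simp_all add: power_add)
      also have "(\<Sum>j\<le>Suc m. (-1) ^ j * push (prism f i) (push (face j) c) y) =
          push (prism f i) (\<lambda>x. \<Sum>j\<le>Suc m. (-1) ^ j * push (face j) c x) y"
        using ch unfolding Suc
        by (intro push_sum[symmetric, OF _ _ iP] push_chain[OF _ controlled_face]) auto
      also have "(\<lambda>x. \<Sum>j\<le>Suc m. (-1) ^ j * push (face j) c x) = (\<lambda>x. 0)"
        using bd ch unfolding Suc by (simp only: uf_boundary_push[symmetric])
      finally show ?thesis by simp
    qed
    thus ?thesis by simp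
  qed simp
  also have "a 0 0 = push (map f) c y"
    unfolding a_def by (rule push_cong[OF ch]) (simp add: face_prism_first[OF len])
  also have "a k (Suc k) = c y"
    unfolding a_def by (rule push_id[OF ch]) (simp add: face_prism_last[OF len])
  finally show ?thesis by simp
qed

section \<open>Averaging a cycle over maps with disjoint images\<close>

lemma average_push_homologous:
  fixes w :: "'i \<Rightarrow> real"
  assumes c: "c \<in> uf_cycles M d k" and J: "finite J" "sum w J = 1"
    and f: "\<And>i x. i \<in> J \<Longrightarrow> x \<in> M \<Longrightarrow> f i x \<in> M \<and> d x (f i x) \<le> R" "0 \<le> R"
  shows "((\<lambda>y. \<Sum>i\<in>J. w i * push (map (f i)) c y), c) \<in> uf_homologous M d k"
proof -
  let ?c' = "\<lambda>y. \<Sum>i\<in>J. w i * push (map (f i)) c y"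
  have ch: "c \<in> uf_chains M d k" using c by (simp add: uf_cycles_def)
  have cyc: "push (map (f i)) c \<in> uf_cycles M d k" if "i \<in> J" for i
    by (rule push_map_cycle[OF c f(1)[OF that]])
  have "?c' \<in> uf_cycles M d k"
    unfolding uf_cycles_def using J(1) cyc
    by (auto simp: uf_boundary_sum uf_cycles_def intro!: uf_chains_sum)
  moreover have "(\<lambda>x. ?c' x - c x) \<in> uf_boundaries M d k"
  proof -
    let ?h = "\<lambda>x. \<Sum>i\<in>J. w i * prism_chain k (f i) c x"
    have hi: "prism_chain k (f i) c \<in> uf_chains M d (k + 1)" if "i \<in> J" for i
      using prism_chain_in[OF ch f(1)[OF that] f(2)] by simp
    have "uf_boundary (k + 1) ?h y = ?c' y - c y" for y
    proof -
      have "uf_boundary (k + 1) ?h y = (\<Sum>i\<in>J. w i * uf_boundary (k + 1) (prism_chain k (f i) c) y)"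
        by (rule uf_boundary_sum[OF J(1) hi])
      also have "\<dots> = (\<Sum>i\<in>J. w i * (push (map (f i)) c y - c y))"
        using boundary_prism_chain[OF c f(1) f(2)] by (intro sum.cong) auto
      also have "\<dots> = ?c' y - sum w J * c y"
        by (simp add: right_diff_distrib sum_subtractf sum_distrib_right)
      finally show ?thesis using J(2) by simp
    qed
    hence "(\<lambda>x. ?c' x - c x) = uf_boundary (k + 1) ?h" by auto
    moreover have "?h \<in> uf_chains M d (k + 1)" using J(1) hi by (rule uf_chains_sum)
    ultimately show ?thesis unfolding uf_boundaries_def by (rule image_eqI)
  qed
  ultimately show ?thesis using c by (simp add: uf_homologous_def)
qed

text \<open>Simplices have at least one vertex, and the first vertex of \<open>y\<close> already determines which of the
  maps \<open>G i\<close> can hit \<open>y\<close>. That map is injective on simplices, so the sum consists of at most one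
  coefficient of \<open>c\<close>, divided by \<open>N\<close>.\<close>

lemma linf_norm_average_push:
  fixes N :: nat
  assumes c: "c \<in> uf_chains M d k" and B: "\<And>x. \<bar>c x\<bar> \<le> B"
    and inj: "inj_on (\<lambda>(i, x). G i x) ({..<N} \<times> M)"
  shows "\<bar>\<Sum>i<N. 1 / N * push (map (G i)) c y\<bar> \<le> B / N"
proof (cases "\<exists>i<N. push (map (G i)) c y \<noteq> 0")
  case False
  hence "(\<Sum>i<N. 1 / N * push (map (G i)) c y) = 0" by (intro sum.neutral) auto
  moreover have "B \<ge> 0" using B[of "[]"] by linarith
  ultimately show ?thesis by simp
next
  case True
  then obtain i x where i: "i < N" and x: "c x \<noteq> 0" "map (G i) x = y"
    using push_nonzero by metis
  have supp: "z \<in> tuples M k" if "c z \<noteq> 0" for z using c that by (simp add: uf_chains_iff)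
  have uniq: "j = i \<and> z = x" if j: "j < N" and z: "c z \<noteq> 0" "map (G j) z = y" for j z
  proof -
    have "x \<noteq> []" "z \<noteq> []" and M: "set x \<subseteq> M" "set z \<subseteq> M"
      using supp[OF x(1)] supp[OF z(1)] by (auto simp: tuples_def)
    hence "G j (hd z) = G i (hd x)" and hd: "hd x \<in> M" "hd z \<in> M"
      using x(2) z(2) by (metis list.map_sel(1), auto)
    hence "j = i" using inj_onD[OF inj, of "(j, hd z)" "(i, hd x)"] i j by simp
    moreover have "inj_on (G i) M" using inj i by (auto simp: inj_on_def)
    hence "inj_on (G i) (set z \<union> set x)" using M by (auto intro: inj_on_subset)
    ultimately show ?thesis using x(2) z(2) by (metis inj_on_map_eq_map)
  qed
  have push: "push (map (G j)) c y = (if j = i then c x else 0)" if "j < N" for j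
  proof (cases "j = i")
    case True
    have "{z. c z \<noteq> 0 \<and> map (G j) z = y} = {x}" using uniq[OF that] x unfolding True by blast
    thus ?thesis unfolding push_def using True by (simp only:) simp
  next
    case False
    hence "{z. c z \<noteq> 0 \<and> map (G j) z = y} = {}" using uniq[OF that] by blast
    thus ?thesis unfolding push_def using False by (simp only:) simp
  qed
  have "(\<Sum>j<N. 1 / N * push (map (G j)) c y) = (\<Sum>j<N. if j = i then c x / N else 0)"
    by (intro sum.cong) (auto simp: push)
  also have "\<dots> = c x / N" using i by simp
  finally show ?thesis using B[of x] by (simp add: divide_right_mono)
qed

end

theorem proposition1p2:
  fixes X :: "'a set" and d :: "'a \<Rightarrow> 'a \<Rightarrow> real" and k :: nat
  assumes "UDBG_space X d" and "\<not> amenable X d"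
  shows "\<forall>\<alpha>\<in>uf_homology X d k. linf_seminorm X d k \<alpha> = 0"
proof
  interpret UDBG_space X d by (rule assms(1))
  fix \<alpha> assume "\<alpha> \<in> uf_homology X d k"
  then obtain c where c: "c \<in> uf_cycles X d k" and \<alpha>: "\<alpha> = uf_homologous X d k `` {c}"
    by (auto simp: uf_homology_def quotient_def)
  have ch: "c \<in> uf_chains X d k" using c by (simp add: uf_cycles_def)
  then obtain B where B: "\<And>x. \<bar>c x\<bar> \<le> B" by (auto simp: uf_chains_iff)
  define S where "S = {linf_norm c | c. c \<in> uf_cycles X d k \<and> uf_homologous X d k `` {c} = \<alpha>}"
  have nonneg: "0 \<le> s" if "s \<in> S" for s
  proof -
    obtain b where b: "s = linf_norm b" "b \<in> uf_cycles X d k" using \<open>s \<in> S\<close> by (auto simp: S_def)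
    hence "bdd_above (range (\<lambda>x. \<bar>b x\<bar>))" by (auto simp: uf_cycles_def uf_chains_def)
    hence "\<bar>b []\<bar> \<le> s" unfolding b(1) linf_norm_def by (intro cSUP_upper) auto
    thus ?thesis by linarith
  qed
  have small: "\<exists>s\<in>S. s \<le> B / N" if N: "N > 0" for N :: nat
  proof -
    obtain G R where R: "R > 0" and inj: "inj_on (\<lambda>(i, x). G i x) ({..<N} \<times> X)"
      and G: "\<And>i x. i < N \<Longrightarrow> x \<in> X \<Longrightarrow> G i x \<in> X \<and> d x (G i x) \<le> R"
      using nonamenable_disjoint_injections[OF assms(2)] by metis
    let ?c' = "\<lambda>y. \<Sum>i<N. 1 / N * push (map (G i)) c y"
    have hom: "(?c', c) \<in> uf_homologous X d k"
      using N R G by (intro average_push_homologous[OF c, where R = R]) auto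
    have "uf_homologous X d k `` {?c'} = \<alpha>"
      unfolding \<alpha> by (rule equiv_class_eq[OF equiv_uf_homologous hom])
    moreover have "?c' \<in> uf_cycles X d k" using hom by (simp add: uf_homologous_def)
    ultimately have "linf_norm ?c' \<in> S" by (auto simp: S_def)
    moreover have "linf_norm ?c' \<le> B / N"
      unfolding linf_norm_def
      by (rule cSUP_least) (use linf_norm_average_push[OF ch B inj] in auto)
    ultimately show ?thesis by blast
  qed
  have bdd: "bdd_below S" by (rule bdd_belowI[OF nonneg])
  have "Inf S \<le> B / Suc n" for n
    using small[of "Suc n"] bdd by (auto intro: cInf_lower2)
  moreover have "(\<lambda>n. B / Suc n) \<longlonglongrightarrow> 0"
    using tendsto_mult_right_zero[OF LIMSEQ_inverse_real_of_nat, of B] by (simp add: divide_inverse)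
  ultimately have "Inf S \<le> 0" by (intro LIMSEQ_le_const) auto
  moreover have "0 \<le> Inf S"
    using small[of 1] nonneg by (intro cInf_greatest) auto
  ultimately show "linf_seminorm X d k \<alpha> = 0" by (simp add: linf_seminorm_def S_def)
qed

end
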